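(* Let $g\in H(\mathbb{D})$ be such that the integral operator $S_g$ is bounded on $BMOA$. Then its operator norm on $BMOA$ is $$\|S_g\|=\sup_{z\in\mathbb{D}}|g(z)|.$$
   Context: $\mathbb{D}$ is the open unit disc in $\mathbb{C}$ and $H(\mathbb{D})$ is the space of analytic functions on $\mathbb{D}$. For $g\in H(\mathbb{D})$, the operator $S_g$ is defined on $H(\mathbb{D})$ by $S_gf(z)=\int_0^z f'(w)g(w)\,dw$. The Hardy space $H^2$ is the space of all $f\in H(\mathbb{D})$ with $\|f\|_{H^2}=\big(\sup_{0<r<1}\frac1{2\pi}\int_0^{2\pi}|f(re^{i\theta})|^2\,d\theta\big)^{1/2}<\infty$. For $a\in\mathbb{D}$ let $\sigma_a(z)=\frac{a-z}{1-\overline{a}z}$. $BMOA$ is the space of all $f\in H^2$ whose boundary function has bounded mean oscillation (equivalently, for which the following norm is finite), with norm $\|f\|_{BMOA}=|f(0)|+\sup_{a\in\mathbb{D}}\|f\circ\sigma_a-f(a)\|_{H^2}$. *)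

theory Defs
  imports "HOL-Complex_Analysis.Complex_Analysis"
begin

text \<open>
  Analytic functions on the unit disc are total functions \<open>complex \<Rightarrow> complex\<close> that are
  holomorphic on \<open>ball 0 1\<close>. Values outside the disc never affect membership in the
  spaces, the norms, or the operator restricted to the disc.
\<close>

abbreviation unit_disc :: "complex set" where
  "unit_disc \<equiv> ball 0 1"

definition S_op :: "(complex \<Rightarrow> complex) \<Rightarrow> (complex \<Rightarrow> complex) \<Rightarrow> complex \<Rightarrow> complex" where
  "S_op g f z = contour_integral (linepath 0 z) (\<lambda>w. deriv f w * g w)"

definition mean_square :: "(complex \<Rightarrow> complex) \<Rightarrow> real \<Rightarrow> real" where
  "mean_square f r =
     1 / (2 * pi) * integral {0..2 * pi} (\<lambda>\<theta>. (norm (f (of_real r * exp (\<i> * of_real \<theta>))))\<^sup>2)"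

definition H2 :: "(complex \<Rightarrow> complex) set" where
  "H2 = {f. f holomorphic_on unit_disc \<and> bdd_above (mean_square f ` {0<..<1})}"

text \<open>The real-valued suprema below are only meaningful for members of the respective space.\<close>

definition H2_norm :: "(complex \<Rightarrow> complex) \<Rightarrow> real" where
  "H2_norm f = sqrt (SUP r\<in>{0<..<1}. mean_square f r)"

definition disc_aut :: "complex \<Rightarrow> complex \<Rightarrow> complex" where
  "disc_aut a z = (a - z) / (1 - cnj a * z)"

text \<open>
  The \<open>H2\<close> clause for the translates holds automatically for \<open>f \<in> H2\<close> (Littlewood subordination);
  it is listed so that each inner norm is a genuine supremum.
\<close>

definition BMOA :: "(complex \<Rightarrow> complex) set" where
  "BMOA = {f \<in> H2. (\<forall>a\<in>unit_disc. (\<lambda>z. f (disc_aut a z) - f a) \<in> H2) \<and>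
                   bdd_above ((\<lambda>a. H2_norm (\<lambda>z. f (disc_aut a z) - f a)) ` unit_disc)}"

definition BMOA_norm :: "(complex \<Rightarrow> complex) \<Rightarrow> real" where
  "BMOA_norm f = norm (f 0) + (SUP a\<in>unit_disc. H2_norm (\<lambda>z. f (disc_aut a z) - f a))"

definition bounded_on_BMOA :: "((complex \<Rightarrow> complex) \<Rightarrow> complex \<Rightarrow> complex) \<Rightarrow> bool" where
  "bounded_on_BMOA T \<longleftrightarrow>
     (\<forall>f\<in>BMOA. T f \<in> BMOA) \<and> (\<exists>C. \<forall>f\<in>BMOA. BMOA_norm (T f) \<le> C * BMOA_norm f)"

definition BMOA_opnorm :: "((complex \<Rightarrow> complex) \<Rightarrow> complex \<Rightarrow> complex) \<Rightarrow> real" where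
  "BMOA_opnorm T = (SUP f\<in>{f \<in> BMOA. BMOA_norm f \<le> 1}. BMOA_norm (T f))"

end

theory Submission
  imports Defs
begin

text \<open>
  The function \<open>S_op g f\<close> vanishes at \<open>0\<close> and has derivative \<open>g f'\<close>, so on derivatives the
  operator is multiplication by \<open>g\<close>. Both inequalities follow from this.

  For \<open>\<le>\<close>, suppose \<open>|g| \<le> M\<close> on the disc. Put \<open>F = f \<circ> \<sigma>\<^sub>a - f a\<close> and let \<open>G\<close> be the same
  translate of \<open>S_op g f\<close>. By the chain rule \<open>G' = (g \<circ> \<sigma>\<^sub>a) F'\<close>, hence \<open>|G'| \<le> M |F'|\<close>, while
  \<open>G 0 = 0\<close>. Such a bound passes to the square means on every circle
  (\<open>mean_square_le_if_deriv_le\<close>, an elementary substitute for the Littlewood--Paley identity):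
  by Parseval (\<open>mean_square_sums\<close>) the square mean of \<open>F\<close> is a power series \<open>I\<close> in \<open>x = r\<^sup>2\<close>,
  that of \<open>F'\<close> is \<open>(x I')'\<close>, and so an inequality between the latter can be integrated twice.
  Taking suprema over \<open>r\<close> and \<open>a\<close> bounds the BMOA norm of \<open>S_op g f\<close> by \<open>M\<close> times that of \<open>f\<close>.

  For \<open>\<ge>\<close>, fix \<open>z\<close> in the disc. The functional \<open>f \<mapsto> f' z\<close> is bounded on BMOA
  (\<open>norm_deriv_le_BMOA_norm\<close>), and \<open>g z\<close> is an eigenvalue of the adjoint of \<open>S_op g\<close> with this
  functional as eigenvector. Concretely, the \<open>n\<close>-th iterate of \<open>S_op g\<close> on the identity function
  has derivative \<open>(g z)\<^sup>n\<close> at \<open>z\<close>, so that \<open>|g z|\<^sup>n \<le> C N\<^sup>n\<close> for all \<open>n\<close>, where \<open>N\<close> is the operator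
  norm and \<open>C\<close> depends only on \<open>z\<close>. This forces \<open>|g z| \<le> N\<close> (\<open>norm_symbol_le_opnorm\<close>); in
  particular boundedness of the operator implies boundedness of \<open>g\<close>.
\<close>

section \<open>Parseval's identity on circles\<close>

text \<open>Cauchy's formula for the Taylor coefficients. On the circle of radius \<open>r\<close> the kernel
  \<open>w\<^sup>-\<^sup>n\<close> is \<open>cnj (w\<^sup>n) / r\<^sup>2\<^sup>n\<close>.\<close>

lemma circle_coefficient_integral:
  fixes f :: "complex \<Rightarrow> complex"
  assumes f: "f holomorphic_on ball 0 1" and r: "0 < r" "r < 1"
  shows "((\<lambda>\<theta>. f (of_real r * exp (\<i> * of_real \<theta>)) * cnj ((of_real r * exp (\<i> * of_real \<theta>)) ^ n))
           has_integral (2 * pi * r ^ (2 * n)) * ((deriv ^^ n) f 0 / fact n)) {0..2 * pi}"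
proof -
  let ?w = "\<lambda>\<theta>::real. of_real r * exp (\<i> * of_real \<theta>) :: complex"
  have "((\<lambda>u. f u / (u - 0) ^ Suc n) has_contour_integral
           (2 * pi * \<i>) / fact n * (deriv ^^ n) f 0) (circlepath 0 r)"
  proof (rule Cauchy_has_contour_integral_higher_derivative_circlepath)
    have sub: "cball 0 r \<subseteq> (ball 0 1 :: complex set)"
      using r by auto
    show "continuous_on (cball 0 r) f"
      using f sub by (meson holomorphic_on_imp_continuous_on continuous_on_subset)
    show "f holomorphic_on ball 0 r"
      using f r by (auto intro: holomorphic_on_subset)
  qed (use r in auto)
  then have "((\<lambda>t. f (0 + r * cis t) / (0 + r * cis t - 0) ^ Suc n * r * \<i> * cis t) has_integral
           (2 * pi * \<i>) / fact n * (deriv ^^ n) f 0) {0..2 * pi}"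
    unfolding circlepath_def by (subst (asm) has_contour_integral_part_circlepath_iff) auto
  then have "((\<lambda>t. (r ^ (2 * n) / \<i>) * (f (0 + r * cis t) / (0 + r * cis t - 0) ^ Suc n * r * \<i> * cis t)) has_integral
           (r ^ (2 * n) / \<i>) * ((2 * pi * \<i>) / fact n * (deriv ^^ n) f 0)) {0..2 * pi}"
    by (rule has_integral_mult_right)
  moreover have "(r ^ (2 * n) / \<i>) * (f (0 + r * cis t) / (0 + r * cis t - 0) ^ Suc n * r * \<i> * cis t)
                  = f (?w t) * cnj (?w t ^ n)" for t
  proof -
    have w: "complex_of_real r * cis t = ?w t"
      by (simp add: cis_conv_exp)
    have nz: "?w t \<noteq> 0" using r by simp
    have "?w t * cnj (?w t) = of_real (r ^ 2)"
      unfolding complex_norm_square [symmetric] using r by (simp add: norm_mult)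
    then have "?w t ^ n * cnj (?w t ^ n) = of_real (r ^ (2 * n))"
      by (metis complex_cnj_power of_real_power power_mult power_mult_distrib)
    then have "cnj (?w t ^ n) = of_real (r ^ (2 * n)) / ?w t ^ n"
      using nz by (simp add: field_simps)
    moreover have "(r ^ (2 * n) / \<i>) * (f (0 + r * cis t) / (0 + r * cis t - 0) ^ Suc n * r * \<i> * cis t)
        = (r ^ (2 * n) / \<i>) * (f (?w t) / ?w t ^ Suc n * \<i> * ?w t)"
      by (simp only: add_0_left diff_zero w [symmetric] mult_ac)
    moreover have "\<dots> = f (?w t) * (of_real (r ^ (2 * n)) / ?w t ^ n)"
      using nz by (simp add: field_simps)
    ultimately show ?thesis by (simp only:)
  qed
  ultimately show ?thesis
    by (simp add: mult_ac)
qed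

lemma summable_norm_taylor:
  fixes f :: "complex \<Rightarrow> complex"
  assumes f: "f holomorphic_on ball 0 1" and r: "0 \<le> r" "r < 1"
  shows "summable (\<lambda>n. norm ((deriv ^^ n) f 0 / fact n) * r ^ n)"
proof -
  obtain s where s: "r < s" "s < 1" using r dense by blast
  have "(\<lambda>n. (deriv ^^ n) f 0 / fact n * (of_real s - 0) ^ n) sums f (of_real s)"
    by (rule holomorphic_power_series [OF f]) (use r s in auto)
  then have "summable (\<lambda>n. (deriv ^^ n) f 0 / fact n * of_real s ^ n)"
    by (auto simp: sums_iff)
  then have "summable (\<lambda>n. norm ((deriv ^^ n) f 0 / fact n * (of_real r :: complex) ^ n))"
    by (rule powser_insidea) (use r s in auto)
  then show ?thesis
    using r by (simp add: norm_mult norm_power norm_divide)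
qed

text \<open>Parseval: integrate \<open>f \<cdot> cnj f\<close> along the circle, expanding only the conjugate factor,
  so that every term is a Cauchy integral for a Taylor coefficient.\<close>

lemma mean_square_sums:
  fixes f :: "complex \<Rightarrow> complex"
  assumes f: "f holomorphic_on ball 0 1" and r: "0 < r" "r < 1"
  shows "(\<lambda>n. (norm ((deriv ^^ n) f 0 / fact n))\<^sup>2 * (r\<^sup>2) ^ n) sums mean_square f r"
proof -
  define a where "a n = (deriv ^^ n) f 0 / fact n" for n
  define w where "w \<theta> = (of_real r * exp (\<i> * of_real \<theta>) :: complex)" for \<theta> :: real
  define h where "h n \<theta> = cnj (a n) * (f (w \<theta>) * cnj (w \<theta> ^ n))" for n \<theta>
  have nw: "norm (w \<theta>) = r" for \<theta> using r by (simp add: w_def norm_mult)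
  have cf: "continuous_on (sphere 0 r) f"
    by (rule continuous_on_subset [OF holomorphic_on_imp_continuous_on [OF f]]) (use r in auto)
  have cw: "continuous_on {0..2 * pi} w"
    unfolding w_def by (intro continuous_intros)
  have cfw: "continuous_on {0..2 * pi} (\<lambda>\<theta>. f (w \<theta>))"
    by (rule continuous_on_compose2 [OF cf cw]) (auto simp: nw)
  have "bounded (f ` sphere 0 r)"
    by (intro compact_imp_bounded compact_continuous_image cf) auto
  then obtain B where B: "\<And>z. norm z = r \<Longrightarrow> norm (f z) \<le> B"
    unfolding bounded_iff by (metis imageI mem_sphere_0)
  \<comment> \<open>The expansion converges uniformly on the circle, so it may be integrated termwise.\<close>
  have "uniform_limit {0..2 * pi} (\<lambda>n \<theta>. \<Sum>i<n. h i \<theta>) (\<lambda>\<theta>. suminf (\<lambda>i. h i \<theta>)) sequentially"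
  proof (rule Weierstrass_m_test)
    show "norm (h n \<theta>) \<le> B * (norm (a n) * r ^ n)" for n \<theta>
    proof -
      have "norm (h n \<theta>) = norm (f (w \<theta>)) * (norm (a n) * r ^ n)"
        by (simp add: h_def norm_mult norm_power nw)
      also have "\<dots> \<le> B * (norm (a n) * r ^ n)"
        using r B [OF nw] by (intro mult_right_mono) auto
      finally show ?thesis .
    qed
    show "summable (\<lambda>n. B * (norm (a n) * r ^ n))"
      unfolding a_def by (intro summable_mult summable_norm_taylor f) (use r in auto)
  qed
  moreover have "suminf (\<lambda>i. h i \<theta>) = of_real ((norm (f (w \<theta>)))\<^sup>2)" for \<theta>
  proof -
    have "(\<lambda>n. a n * (w \<theta> - 0) ^ n) sums f (w \<theta>)"
      unfolding a_def by (rule holomorphic_power_series [OF f]) (use r nw in auto)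
    then have "(\<lambda>n. f (w \<theta>) * cnj (a n * w \<theta> ^ n)) sums (f (w \<theta>) * cnj (f (w \<theta>)))"
      by (intro sums_mult) (simp only: sums_cnj diff_zero)
    moreover have "f (w \<theta>) * cnj (a n * w \<theta> ^ n) = h n \<theta>" for n
      by (simp add: h_def)
    ultimately show ?thesis
      by (simp add: sums_iff complex_norm_square [symmetric])
  qed
  ultimately have ul: "uniform_limit {0..2 * pi} (\<lambda>n \<theta>. \<Sum>i<n. h i \<theta>)
      (\<lambda>\<theta>. of_real ((norm (f (w \<theta>)))\<^sup>2)) sequentially"
    by simp
  have ch: "continuous_on {0..2 * pi} (h i)" for i
    unfolding h_def by (intro continuous_intros cfw cw)
  obtain I J where I: "\<And>n. ((\<lambda>\<theta>. \<Sum>i<n. h i \<theta>) has_integral I n) {0..2 * pi}"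
    and J: "((\<lambda>\<theta>. complex_of_real ((norm (f (w \<theta>)))\<^sup>2)) has_integral J) {0..2 * pi}"
    and lim: "I \<longlonglongrightarrow> J"
    by (rule uniform_limit_integral [OF ul]) (auto intro!: continuous_intros ch)
  have "(h i has_integral of_real (2 * pi * ((norm (a i))\<^sup>2 * (r\<^sup>2) ^ i))) {0..2 * pi}" for i
  proof -
    have "((\<lambda>\<theta>. f (w \<theta>) * cnj (w \<theta> ^ i)) has_integral (2 * pi * r ^ (2 * i)) * a i) {0..2 * pi}"
      unfolding w_def a_def by (rule circle_coefficient_integral [OF f r])
    then have "((\<lambda>\<theta>. cnj (a i) * (f (w \<theta>) * cnj (w \<theta> ^ i))) has_integral
        cnj (a i) * ((2 * pi * r ^ (2 * i)) * a i)) {0..2 * pi}"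
      by (rule has_integral_mult_right)
    moreover have "cnj (a i) * ((2 * pi * r ^ (2 * i)) * a i)
        = of_real (2 * pi * ((norm (a i))\<^sup>2 * (r\<^sup>2) ^ i))"
      unfolding of_real_mult complex_norm_square by (simp add: power_mult)
    ultimately show ?thesis
      unfolding h_def by (simp only:)
  qed
  then have "((\<lambda>\<theta>. \<Sum>i<n. h i \<theta>) has_integral
      (\<Sum>i<n. of_real (2 * pi * ((norm (a i))\<^sup>2 * (r\<^sup>2) ^ i)))) {0..2 * pi}" for n
    by (intro has_integral_sum) auto
  then have "I = (\<lambda>n. \<Sum>i<n. of_real (2 * pi * ((norm (a i))\<^sup>2 * (r\<^sup>2) ^ i)))"
    using I has_integral_unique by blast
  with lim have sJ: "(\<lambda>i. complex_of_real (2 * pi * ((norm (a i))\<^sup>2 * (r\<^sup>2) ^ i))) sums J"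
    by (simp only: sums_def)
  have "((\<lambda>\<theta>. Re (complex_of_real ((norm (f (w \<theta>)))\<^sup>2))) has_integral Re J) {0..2 * pi}"
    by (rule has_integral_Re [OF J])
  then have "integral {0..2 * pi} (\<lambda>\<theta>. (norm (f (w \<theta>)))\<^sup>2) = Re J"
    by (simp add: integral_unique)
  then have ms: "mean_square f r = Re J / (2 * pi)"
    by (simp add: mean_square_def w_def)
  have "(\<lambda>i. 2 * pi * ((norm (a i))\<^sup>2 * (r\<^sup>2) ^ i)) sums Re J"
    using sums_Re [OF sJ] by simp
  then have "(\<lambda>i. 2 * pi * ((norm (a i))\<^sup>2 * (r\<^sup>2) ^ i) / (2 * pi)) sums (Re J / (2 * pi))"
    by (rule sums_divide)
  then show ?thesis
    unfolding ms a_def by simp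
qed

section \<open>Comparison of square means through derivatives\<close>

lemma mean_square_mono:
  fixes F G :: "complex \<Rightarrow> complex"
  assumes F: "F holomorphic_on ball 0 1" and G: "G holomorphic_on ball 0 1"
    and le: "\<And>z. z \<in> ball 0 1 \<Longrightarrow> norm (G z) \<le> M * norm (F z)"
    and r: "0 < r" "r < 1"
  shows "mean_square G r \<le> M\<^sup>2 * mean_square F r"
proof -
  let ?w = "\<lambda>\<theta>::real. of_real r * exp (\<i> * of_real \<theta>) :: complex"
  have int: "(\<lambda>\<theta>. (norm (H (?w \<theta>)))\<^sup>2) integrable_on {0..2 * pi}"
    if "H holomorphic_on ball 0 1" for H
    by (intro integrable_continuous_real continuous_intros
        continuous_on_compose2 [OF holomorphic_on_imp_continuous_on [OF that]])
      (use r in \<open>auto simp: norm_mult\<close>)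
  have "integral {0..2 * pi} (\<lambda>\<theta>. (norm (G (?w \<theta>)))\<^sup>2)
      \<le> integral {0..2 * pi} (\<lambda>\<theta>. M\<^sup>2 * (norm (F (?w \<theta>)))\<^sup>2)"
  proof (rule integral_le)
    show "(norm (G (?w \<theta>)))\<^sup>2 \<le> M\<^sup>2 * (norm (F (?w \<theta>)))\<^sup>2" for \<theta>
    proof -
      have "norm (G (?w \<theta>)) \<le> M * norm (F (?w \<theta>))"
        by (rule le) (use r in \<open>auto simp: norm_mult\<close>)
      then have "(norm (G (?w \<theta>)))\<^sup>2 \<le> (M * norm (F (?w \<theta>)))\<^sup>2"
        by (rule power_mono) auto
      then show ?thesis by (simp only: power_mult_distrib)
    qed
    show "(\<lambda>\<theta>. M\<^sup>2 * (norm (F (?w \<theta>)))\<^sup>2) integrable_on {0..2 * pi}"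
      using integrable_on_cmult_left [OF int [OF F]] by simp
  qed (use int G in auto)
  then have "1 / (2 * pi) * integral {0..2 * pi} (\<lambda>\<theta>. (norm (G (?w \<theta>)))\<^sup>2)
      \<le> 1 / (2 * pi) * (M\<^sup>2 * integral {0..2 * pi} (\<lambda>\<theta>. (norm (F (?w \<theta>)))\<^sup>2))"
    by (intro mult_left_mono) auto
  then show ?thesis
    by (simp add: mean_square_def mult_ac)
qed

text \<open>Here \<open>diffs c\<close> is the coefficient sequence of the derived series.\<close>

lemma powser_nonneg_if_diffs_nonneg:
  fixes c :: "nat \<Rightarrow> real"
  assumes sm: "\<And>x. 0 \<le> x \<Longrightarrow> x < 1 \<Longrightarrow> summable (\<lambda>n. c n * x ^ n)"
    and c0: "0 \<le> c 0"
    and nn: "\<And>x. 0 < x \<Longrightarrow> x < 1 \<Longrightarrow> 0 \<le> (\<Sum>n. diffs c n * x ^ n)"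
    and x: "0 \<le> x" "x < 1"
  shows "0 \<le> (\<Sum>n. c n * x ^ n)"
proof -
  obtain s where s: "x < s" "s < 1" using x dense by blast
  have D: "DERIV (\<lambda>y. \<Sum>n. c n * y ^ n) y :> (\<Sum>n. diffs c n * y ^ n)"
    if "0 \<le> y" "y \<le> x" for y
    by (rule termdiffs_strong [of c s]) (use sm [of s] that s x in auto)
  have "(\<Sum>n. c n * 0 ^ n) \<le> (\<Sum>n. c n * x ^ n)"
  proof (rule DERIV_nonneg_imp_increasing_open [where f = "\<lambda>y. \<Sum>n. c n * y ^ n"])
    show "\<exists>z. DERIV (\<lambda>y. \<Sum>n. c n * y ^ n) y :> z \<and> 0 \<le> z" if "0 < y" "y < x" for y
      using D [of y] nn [of y] that x by (intro exI conjI) auto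
    show "continuous_on {0..x} (\<lambda>y. \<Sum>n. c n * y ^ n)"
    proof (intro continuous_at_imp_continuous_on ballI)
      fix y assume "y \<in> {0..x}"
      then show "isCont (\<lambda>y. \<Sum>n. c n * y ^ n) y"
        by (intro DERIV_isCont [OF D]) auto
    qed
  qed (use x in auto)
  with c0 show ?thesis by simp
qed

text \<open>The power series with coefficients \<open>c n\<close> below is the difference of the two sides. The
  bound on derivatives makes \<open>(x I')'\<close> nonnegative for this series \<open>I\<close>, and two applications of the
  preceding lemma yield \<open>x I' \<ge> 0\<close> and then \<open>I \<ge> 0\<close>.\<close>

lemma mean_square_le_if_deriv_le:
  fixes F G :: "complex \<Rightarrow> complex"
  assumes F: "F holomorphic_on ball 0 1" and G: "G holomorphic_on ball 0 1" and G0: "G 0 = 0"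
    and le: "\<And>z. z \<in> ball 0 1 \<Longrightarrow> norm (deriv G z) \<le> M * norm (deriv F z)"
    and r: "0 < r" "r < 1"
  shows "mean_square G r \<le> M\<^sup>2 * mean_square F r"
proof -
  define a where "a n = (norm ((deriv ^^ n) F 0 / fact n))\<^sup>2" for n
  define b where "b n = (norm ((deriv ^^ n) G 0 / fact n))\<^sup>2" for n
  define c where "c n = M\<^sup>2 * a n - b n" for n
  have cs: "(\<lambda>n. c n * (s\<^sup>2) ^ n) sums (M\<^sup>2 * mean_square F s - mean_square G s)"
    if "0 < s" "s < 1" for s
    using sums_diff [OF sums_mult [OF mean_square_sums [OF F that], of "M\<^sup>2"]
        mean_square_sums [OF G that]]
    by (simp add: c_def a_def b_def algebra_simps)
  have csm: "summable (\<lambda>n. c n * x ^ n)" if "0 \<le> x" "x < 1" for x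
  proof (cases "x = 0")
    case False
    then show ?thesis
      using cs [of "sqrt x"] that by (simp add: sums_iff)
  qed (simp add: summable_0_powser)
  \<comment> \<open>\<open>e\<close> holds the coefficients of \<open>x I'\<close>, where \<open>I\<close> is the series with coefficients \<open>c\<close>.\<close>
  define e where "e n = real n * c n" for n
  have coeff: "(norm ((deriv ^^ n) (deriv H) 0 / fact n))\<^sup>2
      = (real (Suc n))\<^sup>2 * (norm ((deriv ^^ Suc n) H 0 / fact (Suc n)))\<^sup>2" for H :: "complex \<Rightarrow> complex" and n
  proof -
    have "(deriv ^^ n) (deriv H) 0 / fact n
        = of_nat (Suc n) * ((deriv ^^ Suc n) H 0 / fact (Suc n))"
      by (simp add: funpow_swap1 del: of_nat_Suc)
    then show ?thesis
      by (simp only: norm_mult norm_of_nat power_mult_distrib)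
  qed
  have e_diffs: "diffs e n = M\<^sup>2 * (norm ((deriv ^^ n) (deriv F) 0 / fact n))\<^sup>2
      - (norm ((deriv ^^ n) (deriv G) 0 / fact n))\<^sup>2" for n
    unfolding coeff by (simp add: diffs_def e_def c_def a_def b_def algebra_simps power2_eq_square)
  have e_diffs_nonneg: "0 \<le> (\<Sum>n. diffs e n * x ^ n)" if "0 < x" "x < 1" for x
  proof -
    define s where "s = sqrt x"
    have s: "0 < s" "s < 1" "s\<^sup>2 = x" using that by (auto simp: s_def)
    have dF: "deriv F holomorphic_on ball 0 1" and dG: "deriv G holomorphic_on ball 0 1"
      using F G by (auto intro: holomorphic_deriv)
    have "(\<lambda>n. diffs e n * x ^ n) sums (M\<^sup>2 * mean_square (deriv F) s - mean_square (deriv G) s)"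
      using sums_diff [OF sums_mult [OF mean_square_sums [OF dF s(1,2)], of "M\<^sup>2"]
          mean_square_sums [OF dG s(1,2)]]
      by (simp add: e_diffs s(3) algebra_simps)
    moreover have "mean_square (deriv G) s \<le> M\<^sup>2 * mean_square (deriv F) s"
      by (rule mean_square_mono) (use dF dG le s in auto)
    ultimately show ?thesis by (simp add: sums_iff)
  qed
  have dsm: "summable (\<lambda>n. diffs c n * x ^ n)" if "0 \<le> x" "x < 1" for x
  proof (rule termdiff_converges)
    show "norm x < 1" using that by simp
    fix y :: real assume "norm y < 1"
    obtain t where t: "\<bar>y\<bar> < t" "t < 1" using \<open>norm y < 1\<close> dense by auto
    show "summable (\<lambda>n. c n * y ^ n)"
      by (rule summable_norm_cancel, rule powser_insidea [OF csm [of t]]) (use t in auto)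
  qed
  have ec: "(\<lambda>n. e n * x ^ n) sums (x * (\<Sum>n. diffs c n * x ^ n))" if "0 \<le> x" "x < 1" for x
  proof -
    have "(\<lambda>n. x * (diffs c n * x ^ n)) sums (x * (\<Sum>n. diffs c n * x ^ n))"
      by (intro sums_mult summable_sums dsm that)
    then have "(\<lambda>n. e (Suc n) * x ^ Suc n) sums (x * (\<Sum>n. diffs c n * x ^ n))"
      by (simp add: e_def diffs_def mult_ac)
    then have "(\<lambda>n. e n * x ^ n) sums (x * (\<Sum>n. diffs c n * x ^ n) + e 0 * x ^ 0)"
      by (subst (asm) sums_Suc_iff) simp
    then show ?thesis by (simp add: e_def)
  qed
  have c_diffs_nonneg: "0 \<le> (\<Sum>n. diffs c n * x ^ n)" if x: "0 < x" "x < 1" for x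
  proof -
    have "0 \<le> (\<Sum>n. e n * x ^ n)"
    proof (rule powser_nonneg_if_diffs_nonneg)
      show "summable (\<lambda>n. e n * y ^ n)" if "0 \<le> y" "y < 1" for y
        using ec [OF that] by (simp add: sums_iff)
      show "0 \<le> e 0"
        by (simp add: e_def)
    qed (use e_diffs_nonneg x in auto)
    then have "0 \<le> x * (\<Sum>n. diffs c n * x ^ n)"
      using ec [of x] x by (simp add: sums_iff)
    with x show ?thesis by (simp add: zero_le_mult_iff)
  qed
  have "0 \<le> c 0"
    by (simp add: c_def a_def b_def G0)
  then have "0 \<le> (\<Sum>n. c n * (r\<^sup>2) ^ n)"
    using csm c_diffs_nonneg r
    by (intro powser_nonneg_if_diffs_nonneg [where c = c]) (auto simp: power_less_one_iff)
  with cs [OF r] show ?thesis by (simp add: sums_iff)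
qed

section \<open>The Hardy norm\<close>

lemma mean_square_nonneg: "0 \<le> mean_square f r"
proof -
  have "0 \<le> integral {0..2 * pi} (\<lambda>\<theta>. (norm (f (of_real r * exp (\<i> * of_real \<theta>))))\<^sup>2)"
    by (cases "(\<lambda>\<theta>. (norm (f (of_real r * exp (\<i> * of_real \<theta>))))\<^sup>2) integrable_on {0..2 * pi}")
      (auto intro: integral_nonneg simp: not_integrable_integral)
  then show ?thesis by (simp add: mean_square_def)
qed

lemma SUP_mean_square_nonneg:
  assumes "f \<in> H2"
  shows "0 \<le> (SUP r\<in>{0<..<1}. mean_square f r)"
proof -
  have "mean_square f (1/2) \<le> (SUP r\<in>{0<..<1}. mean_square f r)"
    using assms by (intro cSUP_upper) (auto simp: H2_def)
  with mean_square_nonneg show ?thesis by (rule order_trans)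
qed

lemma H2_norm_nonneg: "f \<in> H2 \<Longrightarrow> 0 \<le> H2_norm f"
  by (simp add: H2_norm_def SUP_mean_square_nonneg)

lemma mean_square_le_H2_norm:
  assumes "f \<in> H2" "0 < r" "r < 1"
  shows "mean_square f r \<le> (H2_norm f)\<^sup>2"
proof -
  have "mean_square f r \<le> (SUP r\<in>{0<..<1}. mean_square f r)"
    using assms by (intro cSUP_upper) (auto simp: H2_def)
  with SUP_mean_square_nonneg [OF assms(1)] show ?thesis by (simp add: H2_norm_def)
qed

lemma H2_norm_leI:
  assumes "0 \<le> M" "\<And>r. 0 < r \<Longrightarrow> r < 1 \<Longrightarrow> mean_square f r \<le> M\<^sup>2"
  shows "H2_norm f \<le> M"
proof -
  have "(SUP r\<in>{0<..<1}. mean_square f r) \<le> M\<^sup>2"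
    by (intro cSUP_least) (use assms in auto)
  with assms(1) show ?thesis
    unfolding H2_norm_def by (intro real_le_lsqrt) auto
qed

text \<open>The linear Taylor coefficient is bounded by keeping only its term in Parseval's identity,
  on the circle of radius \<open>1/2\<close>.\<close>

lemma norm_deriv_0_le_H2_norm:
  assumes "f \<in> H2"
  shows "norm (deriv f 0) \<le> 2 * H2_norm f"
proof -
  have "(\<lambda>n. (norm ((deriv ^^ n) f 0 / fact n))\<^sup>2 * ((1/2)\<^sup>2) ^ n) sums mean_square f (1/2)"
    using assms by (intro mean_square_sums) (auto simp: H2_def)
  then have "(\<Sum>n\<in>{1}. (norm ((deriv ^^ n) f 0 / fact n))\<^sup>2 * ((1/2)\<^sup>2) ^ n) \<le> mean_square f (1/2)"
    unfolding sums_iff by (metis (no_types, lifting) finite.emptyI finite_insert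
        mult_nonneg_nonneg sum_le_suminf zero_le_power zero_le_power2)
  also have "\<dots> \<le> (H2_norm f)\<^sup>2"
    using assms by (intro mean_square_le_H2_norm) auto
  finally have "(norm (deriv f 0))\<^sup>2 \<le> (2 * H2_norm f)\<^sup>2"
    by (simp add: power_mult_distrib power2_eq_square)
  then show ?thesis
    by (rule power2_le_imp_le) (use H2_norm_nonneg [OF assms] in simp)
qed

lemma H2_if_bounded:
  assumes f: "f holomorphic_on ball 0 1"
    and B: "0 \<le> B" "\<And>z. z \<in> ball 0 1 \<Longrightarrow> norm (f z) \<le> B"
  shows "f \<in> H2" "H2_norm f \<le> B"
proof -
  have le: "mean_square f r \<le> B\<^sup>2" if "0 < r" "r < 1" for r
    using mean_square_mono [of "\<lambda>_. 1" f B r] f B that by (simp add: mean_square_def)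
  then show "f \<in> H2"
    using f by (auto simp: H2_def intro!: bdd_aboveI)
  show "H2_norm f \<le> B"
    using B(1) le by (rule H2_norm_leI)
qed

section \<open>Disc automorphisms and the integral operator\<close>

lemma disc_aut_eq: "disc_aut a = (\<lambda>z. - Moebius_function 0 a z)"
  by (simp add: disc_aut_def Moebius_function_simple fun_eq_iff minus_divide_left)

lemma disc_aut_in_disc: "a \<in> ball 0 1 \<Longrightarrow> z \<in> ball 0 1 \<Longrightarrow> disc_aut a z \<in> ball 0 1"
  by (simp add: disc_aut_eq Moebius_function_norm_lt_1)

lemma disc_aut_holomorphic: "a \<in> ball 0 1 \<Longrightarrow> disc_aut a holomorphic_on ball 0 1"
  unfolding disc_aut_eq by (intro holomorphic_intros Moebius_function_holomorphic) simp

lemma disc_aut_0 [simp]: "disc_aut a 0 = a"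
  by (simp add: disc_aut_def)

lemma disc_aut_has_field_derivative_0:
  "(disc_aut a has_field_derivative - of_real (1 - (norm a)\<^sup>2)) (at 0)"
  unfolding disc_aut_def [abs_def] of_real_diff complex_norm_square
  by (auto intro!: derivative_eq_intros)

lemma holomorphic_on_translate:
  assumes "f holomorphic_on ball 0 1" "a \<in> ball 0 1"
  shows "(\<lambda>z. f (disc_aut a z) - f a) holomorphic_on ball 0 1"
  using holomorphic_on_compose_gen [OF disc_aut_holomorphic [OF assms(2)] assms(1)] assms(2)
  by (auto intro!: holomorphic_intros simp: o_def disc_aut_in_disc image_subset_iff
      simp del: mem_ball_0 mem_ball)

lemma deriv_translate:
  assumes f: "(f has_field_derivative D) (at (disc_aut a z))" and "a \<in> ball 0 1" "z \<in> ball 0 1"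
  shows "deriv (\<lambda>z. f (disc_aut a z) - f a) z = D * deriv (disc_aut a) z"
proof -
  have "(disc_aut a has_field_derivative deriv (disc_aut a) z) (at z)"
    using holomorphic_derivI [OF disc_aut_holomorphic] assms by blast
  then have "((\<lambda>z. f (disc_aut a z) - f a) has_field_derivative D * deriv (disc_aut a) z - 0) (at z)"
    by (intro DERIV_diff DERIV_chain2 [where f = f and g = "disc_aut a"] f DERIV_const)
  then show ?thesis
    by (simp add: DERIV_imp_deriv)
qed

lemma S_op_has_field_derivative:
  assumes g: "g holomorphic_on ball 0 1" and f: "f holomorphic_on ball 0 1" and z: "z \<in> ball 0 1"
  shows "(S_op g f has_field_derivative deriv f z * g z) (at z)"
proof -
  have "(\<lambda>w. deriv f w * g w) holomorphic_on ball 0 1"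
    using f g by (intro holomorphic_intros) auto
  then obtain H where H: "\<And>w. w \<in> ball 0 1 \<Longrightarrow>
      (H has_field_derivative deriv f w * g w) (at w within ball 0 1)"
    using holomorphic_convex_primitive' [OF convex_ball open_ball] by blast
  have eq: "S_op g f w = H w - H 0" if "w \<in> ball 0 1" for w
  proof -
    have "closed_segment 0 w \<subseteq> ball 0 1"
      using that by (intro closed_segment_subset) auto
    then have "((\<lambda>w. deriv f w * g w) has_contour_integral
        (H (pathfinish (linepath 0 w)) - H (pathstart (linepath 0 w)))) (linepath 0 w)"
      by (intro contour_integral_primitive [OF H]) auto
    then show ?thesis
      by (simp add: S_op_def contour_integral_unique)
  qed
  have "((\<lambda>w. H w - H 0) has_field_derivative deriv f z * g z - 0) (at z)"
    by (intro DERIV_diff DERIV_const) (use H [OF z] z in \<open>simp add: at_within_open [of z "ball 0 1"]\<close>)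
  then show ?thesis
    using eq by (intro has_field_derivative_transform_within_open [OF _ open_ball z, of _ _ "S_op g f"])
      (auto simp del: mem_ball_0 mem_ball)
qed

lemma S_op_holomorphic:
  assumes "g holomorphic_on ball 0 1" "f holomorphic_on ball 0 1"
  shows "S_op g f holomorphic_on ball 0 1"
  using S_op_has_field_derivative [OF assms] unfolding holomorphic_on_open [OF open_ball] by blast

lemma S_op_0 [simp]: "S_op g f 0 = 0"
  by (simp add: S_op_def)

lemma S_op_cmult:
  assumes g: "g holomorphic_on ball 0 1" and f: "f holomorphic_on ball 0 1" and z: "z \<in> ball 0 1"
  shows "S_op g (\<lambda>w. c * f w) z = c * S_op g f z"
proof -
  have seg: "closed_segment 0 z \<subseteq> ball 0 1"
    using z by (intro closed_segment_subset) auto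
  have "(\<lambda>w. deriv f w * g w) holomorphic_on ball 0 1"
    using f g by (intro holomorphic_intros) auto
  then have int: "(\<lambda>w. deriv f w * g w) contour_integrable_on linepath 0 z"
    using seg by (intro contour_integrable_continuous_linepath holomorphic_on_imp_continuous_on)
      (rule holomorphic_on_subset)
  have "S_op g (\<lambda>w. c * f w) z = contour_integral (linepath 0 z) (\<lambda>w. c * (deriv f w * g w))"
    unfolding S_op_def
  proof (rule contour_integral_cong)
    fix w assume "w \<in> path_image (linepath 0 z)"
    with seg have "f field_differentiable at w"
      using f by (intro holomorphic_on_imp_differentiable_at [OF f]) auto
    then show "deriv (\<lambda>w. c * f w) w * g w = c * (deriv f w * g w)"
      by simp
  qed simp
  also have "\<dots> = c * S_op g f z"
    unfolding S_op_def by (rule contour_integral_lmul [OF int])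
  finally show ?thesis .
qed

section \<open>The BMOA norm\<close>

lemma BMOA_holomorphic: "f \<in> BMOA \<Longrightarrow> f holomorphic_on ball 0 1"
  by (simp add: BMOA_def H2_def)

lemma BMOA_translate_in_H2:
  "f \<in> BMOA \<Longrightarrow> a \<in> ball 0 1 \<Longrightarrow> (\<lambda>z. f (disc_aut a z) - f a) \<in> H2"
  by (simp add: BMOA_def)

lemma H2_norm_translate_le:
  assumes "f \<in> BMOA" "a \<in> ball 0 1"
  shows "norm (f 0) + H2_norm (\<lambda>z. f (disc_aut a z) - f a) \<le> BMOA_norm f"
  unfolding BMOA_norm_def
  using assms by (intro add_left_mono cSUP_upper2 [where x = a]) (auto simp: BMOA_def)

lemma BMOA_norm_nonneg: "f \<in> BMOA \<Longrightarrow> 0 \<le> BMOA_norm f"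
  using H2_norm_translate_le [of f 0] H2_norm_nonneg [OF BMOA_translate_in_H2 [of f 0]]
    norm_ge_zero [of "f 0"] by (simp del: norm_ge_zero)

lemma H2_norm_translate_mono:
  assumes "f \<in> BMOA" "0 \<le> M" "a \<in> ball 0 1"
    and "\<And>r. 0 < r \<Longrightarrow> r < 1 \<Longrightarrow>
      mean_square (\<lambda>z. h (disc_aut a z) - h a) r \<le> M\<^sup>2 * mean_square (\<lambda>z. f (disc_aut a z) - f a) r"
  shows "H2_norm (\<lambda>z. h (disc_aut a z) - h a) \<le> M * H2_norm (\<lambda>z. f (disc_aut a z) - f a)"
proof (rule H2_norm_leI)
  note H2 = BMOA_translate_in_H2 [OF assms(1,3)]
  show "0 \<le> M * H2_norm (\<lambda>z. f (disc_aut a z) - f a)"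
    using assms(2) H2_norm_nonneg [OF H2] by simp
  fix r :: real assume r: "0 < r" "r < 1"
  have "M\<^sup>2 * mean_square (\<lambda>z. f (disc_aut a z) - f a) r
      \<le> M\<^sup>2 * (H2_norm (\<lambda>z. f (disc_aut a z) - f a))\<^sup>2"
    by (intro mult_left_mono mean_square_le_H2_norm H2 r) auto
  with assms(4) [OF r]
  show "mean_square (\<lambda>z. h (disc_aut a z) - h a) r \<le> (M * H2_norm (\<lambda>z. f (disc_aut a z) - f a))\<^sup>2"
    by (simp add: power_mult_distrib)
qed

lemma BMOA_norm_mono:
  assumes f: "f \<in> BMOA" and M: "0 \<le> M" and "norm (h 0) \<le> M * norm (f 0)"
    and "\<And>a r. a \<in> ball 0 1 \<Longrightarrow> 0 < r \<Longrightarrow> r < 1 \<Longrightarrow>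
      mean_square (\<lambda>z. h (disc_aut a z) - h a) r \<le> M\<^sup>2 * mean_square (\<lambda>z. f (disc_aut a z) - f a) r"
  shows "BMOA_norm h \<le> M * BMOA_norm f"
proof -
  have "(SUP a\<in>ball 0 1. H2_norm (\<lambda>z. h (disc_aut a z) - h a)) \<le> M * (BMOA_norm f - norm (f 0))"
  proof (rule cSUP_least)
    fix a :: complex assume a: "a \<in> ball 0 1"
    have "H2_norm (\<lambda>z. h (disc_aut a z) - h a) \<le> M * H2_norm (\<lambda>z. f (disc_aut a z) - f a)"
      using f M a assms(4) [OF a] by (rule H2_norm_translate_mono)
    also have "\<dots> \<le> M * (BMOA_norm f - norm (f 0))"
      using H2_norm_translate_le [OF f a] M by (intro mult_left_mono) auto
    finally show "H2_norm (\<lambda>z. h (disc_aut a z) - h a) \<le> M * (BMOA_norm f - norm (f 0))" .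
  qed simp
  with assms(3) show ?thesis
    unfolding BMOA_norm_def [of h] by (simp add: algebra_simps)
qed

text \<open>The function \<open>h\<close> need only be a multiple of \<open>f\<close> inside the disc, because \<open>S_op g\<close> is
  homogeneous only there.\<close>

lemma BMOA_cmult:
  assumes f: "f \<in> BMOA" and h: "\<And>z. z \<in> ball 0 1 \<Longrightarrow> h z = c * f z"
  shows "h \<in> BMOA" "BMOA_norm h \<le> norm c * BMOA_norm f"
proof -
  have "(\<lambda>z. c * f z) holomorphic_on ball 0 1"
    using BMOA_holomorphic [OF f] by (intro holomorphic_intros)
  then have hol: "h holomorphic_on ball 0 1"
    using h by (subst holomorphic_cong [OF refl]) auto
  have ms: "mean_square (\<lambda>z. h (disc_aut a z) - h a) r
      \<le> (norm c)\<^sup>2 * mean_square (\<lambda>z. f (disc_aut a z) - f a) r"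
    if "a \<in> ball 0 1" "0 < r" "r < 1" for a r
    by (intro mean_square_mono holomorphic_on_translate hol BMOA_holomorphic [OF f] that)
      (use that h disc_aut_in_disc in \<open>simp add: norm_mult flip: right_diff_distrib\<close>)
  show "BMOA_norm h \<le> norm c * BMOA_norm f"
    by (rule BMOA_norm_mono) (use f h ms in \<open>auto simp: norm_mult\<close>)
  have H2I: "k \<in> H2" if "k holomorphic_on ball 0 1" "l \<in> H2"
    "\<And>r. 0 < r \<Longrightarrow> r < 1 \<Longrightarrow> mean_square k r \<le> (norm c)\<^sup>2 * mean_square l r" for k l
  proof -
    have "mean_square k r \<le> (norm c)\<^sup>2 * (H2_norm l)\<^sup>2" if r: "0 < r" "r < 1" for r
    proof -
      have "(norm c)\<^sup>2 * mean_square l r \<le> (norm c)\<^sup>2 * (H2_norm l)\<^sup>2"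
        using mean_square_le_H2_norm [OF \<open>l \<in> H2\<close> r] by (intro mult_left_mono) auto
      with \<open>\<And>r. 0 < r \<Longrightarrow> r < 1 \<Longrightarrow> mean_square k r \<le> (norm c)\<^sup>2 * mean_square l r\<close> [OF r] show ?thesis by simp
    qed
    with that(1) show ?thesis by (auto simp: H2_def intro!: bdd_aboveI)
  qed
  have "h \<in> H2"
  proof (rule H2I [OF hol])
    show "f \<in> H2" using f by (simp add: BMOA_def)
    show "mean_square h r \<le> (norm c)\<^sup>2 * mean_square f r" if "0 < r" "r < 1" for r
      using that h by (intro mean_square_mono hol BMOA_holomorphic [OF f]) (auto simp: norm_mult)
  qed
  moreover have "(\<lambda>z. h (disc_aut a z) - h a) \<in> H2" if "a \<in> ball 0 1" for a
    using H2I [OF holomorphic_on_translate [OF hol that] BMOA_translate_in_H2 [OF f that]] ms [OF that]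
    by blast
  moreover have "H2_norm (\<lambda>z. h (disc_aut a z) - h a) \<le> norm c * BMOA_norm f"
    if a: "a \<in> ball 0 1" for a
  proof -
    have "H2_norm (\<lambda>z. h (disc_aut a z) - h a) \<le> norm c * H2_norm (\<lambda>z. f (disc_aut a z) - f a)"
      using f norm_ge_zero a ms [OF a] by (rule H2_norm_translate_mono)
    also have "\<dots> \<le> norm c * BMOA_norm f"
      using H2_norm_translate_le [OF f a] norm_ge_zero [of "f 0"]
      by (intro mult_left_mono norm_ge_zero) linarith
    finally show ?thesis .
  qed
  ultimately show "h \<in> BMOA"
    by (auto simp: BMOA_def simp del: mem_ball_0 mem_ball intro!: bdd_aboveI2)
qed

lemma id_in_BMOA: "(\<lambda>z. z) \<in> BMOA"
proof -
  have bound: "norm (disc_aut a z - a) \<le> 2" if "a \<in> ball 0 1" "z \<in> ball 0 1" for a z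
    using norm_triangle_ineq4 [of "disc_aut a z" a] disc_aut_in_disc [OF that] that by simp
  have hol: "(\<lambda>z. disc_aut a z - a) holomorphic_on ball 0 1" if "a \<in> ball 0 1" for a
    by (intro holomorphic_intros disc_aut_holomorphic that)
  have "(\<lambda>z. z) \<in> H2"
    by (rule H2_if_bounded(1) [of _ 1]) (auto intro: less_imp_le)
  moreover have "(\<lambda>z. disc_aut a z - a) \<in> H2" if "a \<in> ball 0 1" for a
    using H2_if_bounded(1) [OF hol [OF that], of 2] bound [OF that] by simp
  moreover have "H2_norm (\<lambda>z. disc_aut a z - a) \<le> 2" if "a \<in> ball 0 1" for a
    using H2_if_bounded(2) [OF hol [OF that], of 2] bound [OF that] by simp
  ultimately show ?thesis
    by (auto simp: BMOA_def simp del: mem_ball_0 mem_ball intro!: bdd_aboveI2)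
qed

lemma zero_in_BMOA_unit_ball: "(\<lambda>_. 0) \<in> {f \<in> BMOA. BMOA_norm f \<le> 1}"
  using BMOA_cmult [OF id_in_BMOA, of "\<lambda>_. 0" 0] by auto

text \<open>Derivatives at points of the disc are bounded functionals: translating \<open>z\<close> to the origin
  reduces the claim to the linear Taylor coefficient of a function in \<open>H2\<close>.\<close>

lemma norm_deriv_le_BMOA_norm:
  assumes f: "f \<in> BMOA" and z: "z \<in> ball 0 1"
  shows "norm (deriv f z) * (1 - (norm z)\<^sup>2) \<le> 2 * BMOA_norm f"
proof -
  have "(f has_field_derivative deriv f z) (at (disc_aut z 0))"
    using holomorphic_derivI [OF BMOA_holomorphic [OF f] open_ball z] by simp
  then have "deriv (\<lambda>w. f (disc_aut z w) - f z) 0 = deriv f z * deriv (disc_aut z) 0"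
    using z by (intro deriv_translate) auto
  also have "deriv (disc_aut z) 0 = - of_real (1 - (norm z)\<^sup>2)"
    by (rule DERIV_imp_deriv [OF disc_aut_has_field_derivative_0])
  finally have "norm (deriv (\<lambda>w. f (disc_aut z w) - f z) 0) = norm (deriv f z) * \<bar>1 - (norm z)\<^sup>2\<bar>"
    by (simp only: norm_mult norm_minus_cancel norm_of_real)
  moreover have "(norm z)\<^sup>2 \<le> 1"
    using z by (intro power_le_one) auto
  ultimately have "norm (deriv f z) * (1 - (norm z)\<^sup>2) \<le> 2 * H2_norm (\<lambda>w. f (disc_aut z w) - f z)"
    using norm_deriv_0_le_H2_norm [OF BMOA_translate_in_H2 [OF f z]] by simp
  also have "\<dots> \<le> 2 * BMOA_norm f"
    using H2_norm_translate_le [OF f z] norm_ge_zero [of "f 0"] by linarith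
  finally show ?thesis .
qed

section \<open>The operator norm\<close>

lemma BMOA_norm_S_op_le_sup:
  assumes g: "g holomorphic_on ball 0 1" and M: "\<And>z. z \<in> ball 0 1 \<Longrightarrow> norm (g z) \<le> M"
    and f: "f \<in> BMOA"
  shows "BMOA_norm (S_op g f) \<le> M * BMOA_norm f"
proof (rule BMOA_norm_mono [OF f])
  show M0: "0 \<le> M"
    using M [of 0] norm_ge_zero [of "g 0"] by (simp del: norm_ge_zero)
  show "norm (S_op g f 0) \<le> M * norm (f 0)"
    using M0 by simp
  note holf = BMOA_holomorphic [OF f]
  fix a :: complex and r :: real
  assume a: "a \<in> ball 0 1" and r: "0 < r" "r < 1"
  show "mean_square (\<lambda>z. S_op g f (disc_aut a z) - S_op g f a) r
      \<le> M\<^sup>2 * mean_square (\<lambda>z. f (disc_aut a z) - f a) r"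
  proof (rule mean_square_le_if_deriv_le [OF _ _ _ _ r])
    fix z :: complex assume z: "z \<in> ball 0 1"
    note az = disc_aut_in_disc [OF a z]
    have "deriv (\<lambda>z. S_op g f (disc_aut a z) - S_op g f a) z
        = g (disc_aut a z) * (deriv f (disc_aut a z) * deriv (disc_aut a) z)"
      using deriv_translate [OF S_op_has_field_derivative [OF g holf az] a z] by simp
    also have "deriv f (disc_aut a z) * deriv (disc_aut a) z = deriv (\<lambda>z. f (disc_aut a z) - f a) z"
      using deriv_translate [OF holomorphic_derivI [OF holf open_ball az] a z] by simp
    finally show "norm (deriv (\<lambda>z. S_op g f (disc_aut a z) - S_op g f a) z)
        \<le> M * norm (deriv (\<lambda>z. f (disc_aut a z) - f a) z)"
      using M [OF az] by (simp add: norm_mult mult_right_mono)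
  qed (use a holf S_op_holomorphic [OF g holf] in \<open>auto intro: holomorphic_on_translate\<close>)
qed

lemma bdd_above_BMOA_norm_unit_ball:
  assumes "bounded_on_BMOA T"
  shows "bdd_above ((\<lambda>f. BMOA_norm (T f)) ` {f \<in> BMOA. BMOA_norm f \<le> 1})"
proof -
  obtain C where C: "\<And>f. f \<in> BMOA \<Longrightarrow> BMOA_norm (T f) \<le> C * BMOA_norm f"
    using assms by (auto simp: bounded_on_BMOA_def)
  have "BMOA_norm (T f) \<le> \<bar>C\<bar>" if "f \<in> BMOA" "BMOA_norm f \<le> 1" for f
  proof -
    have "C * BMOA_norm f \<le> \<bar>C\<bar> * 1"
      using that BMOA_norm_nonneg by (intro mult_mono) auto
    with C [OF that(1)] show ?thesis by simp
  qed
  then show ?thesis by (auto intro!: bdd_aboveI2)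
qed

lemma BMOA_norm_S_op_le_opnorm:
  assumes g: "g holomorphic_on ball 0 1" and bdd: "bounded_on_BMOA (S_op g)" and f: "f \<in> BMOA"
  shows "BMOA_norm (S_op g f) \<le> BMOA_opnorm (S_op g) * BMOA_norm f"
proof (cases "BMOA_norm f = 0")
  case True
  \<comment> \<open>Such an \<open>f\<close> cannot be normalised, but the boundedness estimate gives
    \<open>BMOA_norm (S_op g f) \<le> 0\<close> directly.\<close>
  then show ?thesis
    using bdd f by (force simp: bounded_on_BMOA_def)
next
  case False
  define N where "N = BMOA_norm f"
  have N: "0 < N" using False BMOA_norm_nonneg [OF f] by (simp add: N_def)
  define h where "h = (\<lambda>z. of_real (1 / N) * f z)"
  have h: "h \<in> BMOA" "BMOA_norm h \<le> 1"
    using BMOA_cmult [OF f, of h "of_real (1 / N)"] N by (auto simp: h_def N_def [symmetric] norm_divide)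
  have le: "BMOA_norm (S_op g h) \<le> BMOA_opnorm (S_op g)"
    unfolding BMOA_opnorm_def
    by (rule cSUP_upper [OF _ bdd_above_BMOA_norm_unit_ball [OF bdd]]) (use h in simp)
  have "S_op g f z = of_real N * S_op g h z" if "z \<in> ball 0 1" for z
    using S_op_cmult [OF g BMOA_holomorphic [OF f] that, of "of_real (1 / N)"] N
    by (simp add: h_def)
  moreover have "S_op g h \<in> BMOA"
    using bdd h by (simp add: bounded_on_BMOA_def)
  ultimately have "BMOA_norm (S_op g f) \<le> N * BMOA_norm (S_op g h)"
    using BMOA_cmult(2) [of "S_op g h" "S_op g f" "of_real N"] N by simp
  also have "\<dots> \<le> N * BMOA_opnorm (S_op g)"
    using le N by (intro mult_left_mono) auto
  finally show ?thesis by (simp add: N_def mult.commute)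
qed

lemma BMOA_opnorm_nonneg:
  assumes "bounded_on_BMOA T"
  shows "0 \<le> BMOA_opnorm T"
proof -
  note z = zero_in_BMOA_unit_ball
  have "0 \<le> BMOA_norm (T (\<lambda>_. 0))"
    using assms z by (intro BMOA_norm_nonneg) (simp add: bounded_on_BMOA_def)
  also have "\<dots> \<le> BMOA_opnorm T"
    unfolding BMOA_opnorm_def
    by (rule cSUP_upper [OF _ bdd_above_BMOA_norm_unit_ball [OF assms]]) (use z in simp)
  finally show ?thesis .
qed

lemma le_if_powers_le:
  fixes x y C :: real
  assumes "0 \<le> y" and le: "\<And>n. x ^ n \<le> C * y ^ n"
  shows "x \<le> y"
proof (cases "y = 0")
  case True
  then show ?thesis using le [of 1] by simp
next
  case False
  then have y: "0 < y" using assms(1) by simp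
  show ?thesis
  proof (rule ccontr)
    assume "\<not> x \<le> y"
    then have "1 < x / y" using y by simp
    then obtain n where "C < (x / y) ^ n" using real_arch_pow by blast
    then have "C * y ^ n < x ^ n" using y by (simp add: power_divide field_simps)
    with le [of n] show False by simp
  qed
qed

lemma norm_symbol_le_opnorm:
  assumes g: "g holomorphic_on ball 0 1" and bdd: "bounded_on_BMOA (S_op g)" and z: "z \<in> ball 0 1"
  shows "norm (g z) \<le> BMOA_opnorm (S_op g)"
proof -
  let ?N = "BMOA_opnorm (S_op g)"
  define F where "F n = (S_op g ^^ n) (\<lambda>z. z)" for n
  note N0 = BMOA_opnorm_nonneg [OF bdd]
  have F: "F n \<in> BMOA" for n
    using bdd by (induction n) (auto simp: F_def id_in_BMOA bounded_on_BMOA_def)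
  have F_norm: "BMOA_norm (F n) \<le> ?N ^ n * BMOA_norm (\<lambda>z. z)" for n
  proof (induction n)
    case (Suc n)
    have "BMOA_norm (F (Suc n)) \<le> ?N * BMOA_norm (F n)"
      using BMOA_norm_S_op_le_opnorm [OF g bdd F [of n]] by (simp add: F_def)
    also have "\<dots> \<le> ?N * (?N ^ n * BMOA_norm (\<lambda>z. z))"
      using Suc N0 by (rule mult_left_mono)
    finally show ?case by (simp add: mult_ac)
  qed (simp add: F_def)
  have F_deriv: "deriv (F n) z = g z ^ n" for n
  proof (induction n)
    case (Suc n)
    have "deriv (F (Suc n)) z = deriv (F n) z * g z"
      using S_op_has_field_derivative [OF g BMOA_holomorphic [OF F] z, of n]
      by (simp add: F_def DERIV_imp_deriv)
    with Suc show ?case by simp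
  qed (simp add: F_def)
  have pos: "0 < 1 - (norm z)\<^sup>2"
    using z by (simp add: power_less_one_iff)
  have "norm (g z) ^ n \<le> (2 * BMOA_norm (\<lambda>z. z) / (1 - (norm z)\<^sup>2)) * ?N ^ n" for n
  proof -
    have "norm (g z) ^ n * (1 - (norm z)\<^sup>2) \<le> 2 * BMOA_norm (F n)"
      using norm_deriv_le_BMOA_norm [OF F z, of n] by (simp add: F_deriv norm_power)
    also have "\<dots> \<le> 2 * (?N ^ n * BMOA_norm (\<lambda>z. z))"
      using F_norm by simp
    finally show ?thesis
      using pos by (simp add: field_simps)
  qed
  with N0 show ?thesis by (rule le_if_powers_le)
qed

theorem lemma6:
  fixes g :: "complex \<Rightarrow> complex"
  assumes "g holomorphic_on unit_disc"
    and "bounded_on_BMOA (S_op g)"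
  shows "ereal (BMOA_opnorm (S_op g)) = (SUP z\<in>unit_disc. ereal (norm (g z)))"
proof (rule antisym)
  show le: "(SUP z\<in>unit_disc. ereal (norm (g z))) \<le> ereal (BMOA_opnorm (S_op g))"
    using norm_symbol_le_opnorm [OF assms] by (intro SUP_least) simp
  have ge: "ereal (norm (g z)) \<le> (SUP z\<in>unit_disc. ereal (norm (g z)))" if "z \<in> unit_disc" for z
    using that by (rule SUP_upper)
  have "0 \<le> (SUP z\<in>unit_disc. ereal (norm (g z)))"
    using ge [of 0] by (simp add: order_trans [rotated])
  with le obtain M where M: "(SUP z\<in>unit_disc. ereal (norm (g z))) = ereal M" "0 \<le> M"
    by (cases "SUP z\<in>unit_disc. ereal (norm (g z))") auto
  have gM: "norm (g z) \<le> M" if "z \<in> unit_disc" for z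
    using ge [OF that] M by simp
  have "BMOA_opnorm (S_op g) \<le> M"
    unfolding BMOA_opnorm_def
  proof (rule cSUP_least)
    show "{f \<in> BMOA. BMOA_norm f \<le> 1} \<noteq> {}"
      using zero_in_BMOA_unit_ball by blast
    fix f assume f: "f \<in> {f \<in> BMOA. BMOA_norm f \<le> 1}"
    then have "BMOA_norm (S_op g f) \<le> M * BMOA_norm f"
      by (intro BMOA_norm_S_op_le_sup assms gM) auto
    also have "\<dots> \<le> M"
      using f M(2) by (simp add: mult_left_le)
    finally show "BMOA_norm (S_op g f) \<le> M" .
  qed
  with M show "ereal (BMOA_opnorm (S_op g)) \<le> (SUP z\<in>unit_disc. ereal (norm (g z)))"
    by simp
qed

end
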